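(* Let $V$ be an $n$-dimensional vector space over the finite field $\mathbb{F}_q$, let $k$ be a positive integer with $k\le n/2$, and let $\mathcal{S}^*$ be a family of $s$ subspaces of $V$ of codimension $k$. Assume $s\ge 2$ and that there is an integer $d\ge 2$ such that (1) for every $v\in V\setminus\{0\}$, $|\{M\in\mathcal{S}^*: v\in M\}|\in\{0,d\}$, and both values occur; and (2) for all distinct $M,M^*\in\mathcal{S}^*$, $\dim(M\cap M^* )=n-2k$. Let $Y=V$, let $Z=\bigcup_{M\in\mathcal{S}^*}V/M$ (the set of all cosets $b+M$ with $b\in V$, $M\in\mathcal{S}^*$), and let $G$ be the bipartite graph on $Y\cup Z$ in which $v\in Y$ is adjacent to $B\in Z$ iff $v\in B$. Then $G$ is distance-biregular with intersection array \[ \begin{vmatrix} s; & 1, & d, & q^{n-2k}(s-1)/d, & s\\ q^{n-k}; & 1, & q^{n-2k}, & s-1, & q^{n-k}\end{vmatrix}. \]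
   Context: A bipartite graph with bipartition $Y\cup Z$ is distance-biregular if for every vertex $a$, every $i$, and every vertex $w$ at distance $i$ from $a$, the numbers $c_i(a)=|\{u\sim w: d(a,u)=i-1\}|$ and $b_i(a)=|\{u\sim w: d(a,u)=i+1\}|$ depend only on $i$ and on which part contains $a$; write $c_i^Y$, $c_i^Z$ for these numbers. The intersection array $\begin{vmatrix} k; & c_1^{Y}, & \dots, & c_{d_Y}^{Y} \\ \ell; & c_1^{Z}, & \dots, & c_{d_Z}^{Z}\end{vmatrix}$ records the valency $k$ of vertices of $Y$, the valency $\ell$ of vertices of $Z$, and the numbers $c_i^Y$ ($1\le i\le d_Y$), $c_i^Z$ ($1\le i\le d_Z$), where $d_Y,d_Z$ are the eccentricities of vertices in $Y$, $Z$ respectively. *)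

theory Defs
  imports Complex_Main "HOL-Library.Cardinality" "Graph_Theory.Graph_Theory"
begin

text \<open>Undirected simple graphs are symmetric loop-free pair digraphs, i.e. the locale
  \<open>pair_graph\<close>: each edge is represented by its two orientations.\<close>

definition bipartite_graph :: "'a pair_pre_digraph \<Rightarrow> 'a set \<Rightarrow> 'a set \<Rightarrow> bool" where
  "bipartite_graph G Y Z \<longleftrightarrow>
     pair_graph G \<and> pverts G = Y \<union> Z \<and> Y \<inter> Z = {} \<and>
     parcs G \<subseteq> (Y \<times> Z) \<union> (Z \<times> Y)"

text \<open>Unit weights turn the cost of a walk into its length; the value is \<open>\<infinity>\<close> between different
  components.\<close>

definition gdist :: "'a pair_pre_digraph \<Rightarrow> 'a \<Rightarrow> 'a \<Rightarrow> ereal" where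
  "gdist G u v = wf_digraph.\<mu> (with_proj G) (\<lambda>_. 1) u v"

definition eccentricity :: "'a pair_pre_digraph \<Rightarrow> 'a \<Rightarrow> ereal" where
  "eccentricity G a = (SUP w \<in> pverts G. gdist G a w)"

text \<open>\<open>c_num G a i w\<close> and \<open>b_num G a i w\<close> are meant for \<open>w\<close> at distance \<open>i\<close> from \<open>a\<close>. Subtracting in
  the reals, and not in \<open>nat\<close>, makes \<open>c_num G a 0 w = 0\<close>.\<close>

definition c_num :: "'a pair_pre_digraph \<Rightarrow> 'a \<Rightarrow> nat \<Rightarrow> 'a \<Rightarrow> nat" where
  "c_num G a i w = card {u. (u, w) \<in> parcs G \<and> gdist G a u = ereal (real i - 1)}"

definition b_num :: "'a pair_pre_digraph \<Rightarrow> 'a \<Rightarrow> nat \<Rightarrow> 'a \<Rightarrow> nat" where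
  "b_num G a i w = card {u. (u, w) \<in> parcs G \<and> gdist G a u = ereal (real i + 1)}"

definition distance_biregular :: "'a pair_pre_digraph \<Rightarrow> 'a set \<Rightarrow> 'a set \<Rightarrow> bool" where
  "distance_biregular G Y Z \<longleftrightarrow>
     bipartite_graph G Y Z \<and>
     (\<forall>P \<in> {Y, Z}. \<forall>i. \<exists>c b. \<forall>a \<in> P. \<forall>w \<in> pverts G.
        gdist G a w = ereal (real i) \<longrightarrow> c_num G a i w = c \<and> b_num G a i w = b)"

text \<open>One line of an intersection array, for the part \<open>P\<close>: the valency and the list of the numbers
  \<open>c\<^sub>1, \<dots>, c\<^sub>e\<close>, with \<open>e\<close> the common eccentricity of the vertices of \<open>P\<close>; list positions start
  at 0. The entries are real numbers so that an array may be written with exact quotients.\<close>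

definition array_line :: "'a pair_pre_digraph \<Rightarrow> 'a set \<Rightarrow> nat \<Rightarrow> real list \<Rightarrow> bool" where
  "array_line G P val cs \<longleftrightarrow>
     (\<forall>a \<in> P. out_degree (with_proj G) a = val \<and>
        eccentricity G a = ereal (real (length cs)) \<and>
        (\<forall>i \<in> {1..length cs}. \<forall>w \<in> pverts G.
           gdist G a w = ereal (real i) \<longrightarrow> real (c_num G a i w) = cs ! (i - 1)))"

definition has_intersection_array ::
    "'a pair_pre_digraph \<Rightarrow> 'a set \<Rightarrow> 'a set \<Rightarrow> nat \<times> real list \<Rightarrow> nat \<times> real list \<Rightarrow> bool" where
  "has_intersection_array G Y Z lineY lineZ \<longleftrightarrow>
     array_line G Y (fst lineY) (snd lineY) \<and> array_line G Z (fst lineZ) (snd lineZ)"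

definition cosets :: "'v::ab_group_add set \<Rightarrow> 'v set set" where
  "cosets M = range (\<lambda>b. (+) b ` M)"

definition point_verts :: "('v + 'v set) set" where
  "point_verts = range Inl"

definition coset_verts :: "'v::ab_group_add set set \<Rightarrow> ('v + 'v set) set" where
  "coset_verts S = Inr ` (\<Union>M \<in> S. cosets M)"

definition incidence_graph :: "'v::ab_group_add set set \<Rightarrow> ('v + 'v set) pair_pre_digraph" where
  "incidence_graph S =
     (let E = {(Inl v, Inr B) | v B. B \<in> (\<Union>M \<in> S. cosets M) \<and> v \<in> B}
      in \<lparr> pverts = point_verts \<union> coset_verts S, parcs = E \<union> E\<inverse> \<rparr>)"

end

theory Submission
  imports Defs
begin

text \<open>Because the members of \<open>S\<close> have dimension \<open>n - k\<close> and meet pairwise in dimension \<open>n - 2k\<close>, any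
  two distinct ones span \<open>V\<close>; hence cosets of different members of \<open>S\<close> always meet. So two points are
  at distance 2 or 4 according to whether their difference is covered by \<open>S\<close>, a point and a coset
  are at distance 1 or 3, and two distinct cosets are at distance 2 or 4 according to whether they
  meet. The numbers \<open>c\<^sub>i\<close> are then sizes of intersections of cosets or numbers of cosets through
  given points, except \<open>c\<^sub>3\<close> from a point, which comes from a double count. The \<open>b\<^sub>i\<close> are valencies
  minus \<open>c\<^sub>i\<close>, as the graph is bipartite. Beyond spanning, only the additive group structure of \<open>V\<close>
  matters.\<close>

section \<open>Bipartite graphs with an explicit distance function\<close>

text \<open>A certificate that \<open>D\<close> is the graph distance: along an arc \<open>D\<close>
  grows by at most one, and positive \<open>c\<close> values supply a neighbour one step closer to
  \<open>a\<close>. The part of the base vertex \<open>a\<close> selects \<open>cY\<close> or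
  \<open>cZ\<close>.\<close>

locale distance_profile =
  fixes G :: "'a pair_pre_digraph" and Y Z :: "'a set"
    and D :: "'a \<Rightarrow> 'a \<Rightarrow> nat" and cY cZ :: "nat \<Rightarrow> nat" and kY kZ :: nat
  assumes bip: "bipartite_graph G Y Z"
    and D_eq_0_iff: "\<lbrakk>a \<in> pverts G; w \<in> pverts G\<rbrakk> \<Longrightarrow> D a w = 0 \<longleftrightarrow> w = a"
    and D_parity: "\<lbrakk>a \<in> pverts G; w \<in> pverts G\<rbrakk> \<Longrightarrow> even (D a w) \<longleftrightarrow> (a \<in> Y \<longleftrightarrow> w \<in> Y)"
    and D_adj: "\<lbrakk>a \<in> pverts G; (u, w) \<in> parcs G\<rbrakk> \<Longrightarrow> D a w \<le> Suc (D a u)"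
    and c_pos: "\<lbrakk>a \<in> pverts G; w \<in> pverts G; w \<noteq> a\<rbrakk> \<Longrightarrow> 0 < (if a \<in> Y then cY else cZ) (D a w)"
    and card_pred: "\<lbrakk>a \<in> pverts G; w \<in> pverts G; w \<noteq> a\<rbrakk> \<Longrightarrow>
      card {u. (u, w) \<in> parcs G \<and> Suc (D a u) = D a w} = (if a \<in> Y then cY else cZ) (D a w)"
    and card_nbhd: "a \<in> pverts G \<Longrightarrow> card {u. (u, a) \<in> parcs G} = (if a \<in> Y then kY else kZ)"
begin

section \<open>Walk lengths and the candidate distance\<close>

lemma graph: "pair_graph G"
  using bip by (simp add: bipartite_graph_def)

sublocale pair_graph G
  by (rule graph)

text \<open>The two ends lie in different parts, so parity excludes equal values;
  \<open>D_adj\<close> along both orientations bounds the difference by one.\<close>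

lemma arc_D:
  assumes "a \<in> pverts G" "(u, w) \<in> parcs G"
  shows "D a u = Suc (D a w) \<or> D a w = Suc (D a u)"
proof -
  have wu: "(w, u) \<in> parcs G"
    using assms(2) by (rule arcs_symmetric)
  have "u \<in> Y \<longleftrightarrow> w \<notin> Y" "u \<in> pverts G" "w \<in> pverts G"
    using bip assms(2) by (auto simp: bipartite_graph_def)
  then have "even (D a u) \<longleftrightarrow> odd (D a w)"
    using assms(1) D_parity by auto
  then have "D a u \<noteq> D a w" by auto
  then show ?thesis
    using D_adj[OF assms] D_adj[OF assms(1) wu] by linarith
qed

text \<open>Summing \<open>D_adj\<close> along the walk. With \<open>u = a\<close> this is the lower
  bound on the graph distance.\<close>

lemma D_le_awalk_length:
  assumes "awalk u p w" "a \<in> pverts G"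
  shows "D a w \<le> D a u + length p"
  using assms
proof (induction p arbitrary: u)
  case (Cons e p)
  then have "D a w \<le> D a (snd e) + length p" "D a (snd e) \<le> Suc (D a u)"
    using D_adj[of a "fst e" "snd e"] by (auto simp: awalk_Cons_iff)
  then show ?case by simp
qed (simp add: awalk_Nil_iff)

text \<open>Descent towards \<open>a\<close>: positivity of the predecessor count gives a neighbour
  of \<open>w\<close> with smaller \<open>D\<close>, whose walk is extended by one arc.\<close>

lemma exists_awalk_length_D:
  assumes "a \<in> pverts G" "w \<in> pverts G"
  shows "\<exists>p. awalk a p w \<and> length p = D a w"
  using assms(2)
proof (induction "D a w" arbitrary: w rule: less_induct)
  case less
  show ?case
  proof (cases "w = a")
    case True
    then show ?thesis
      using assms D_eq_0_iff[of a a] by (intro exI[of _ "[]"]) (simp add: awalk_Nil_iff)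
  next
    case False
    then have "card {u. (u, w) \<in> parcs G \<and> Suc (D a u) = D a w} > 0"
      using assms less c_pos card_pred by simp
    then obtain u where u: "(u, w) \<in> parcs G" "Suc (D a u) = D a w"
      by (auto simp: card_gt_0_iff)
    then obtain p where p: "awalk a p u" "length p = D a u"
      using less(1)[of u] in_arcsD1 by auto
    have "awalk u [(u, w)] w"
      using u(1) by (simp add: awalk_simps wellformed')
    then have "awalk a (p @ [(u, w)]) w"
      using p(1) by (rule awalk_appendI[rotated])
    then show ?thesis
      using p u by (intro exI[of _ "p @ [(u, w)]"]) simp
  qed
qed

lemma awalk_cost_unit: "awalk_cost (\<lambda>_. 1) p = real (length p)"
  by (induction p) simp_all

lemma gdist_eq_D:
  assumes "a \<in> pverts G" "w \<in> pverts G"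
  shows "gdist G a w = ereal (real (D a w))"
proof -
  have "D a a = 0"
    using assms D_eq_0_iff by simp
  then have lower: "D a w \<le> length p" if "awalk a p w" for p
    using D_le_awalk_length[OF that assms(1)] by simp
  obtain p where p: "awalk a p w" "length p = D a w"
    using exists_awalk_length_D[OF assms] by blast
  show ?thesis
    \<comment> \<open>An infimum over walks: \<open>lower\<close> bounds every length from below,
      and \<open>p\<close> attains the bound.\<close>
    unfolding gdist_def \<mu>_def awalk_cost_unit
    using p lower by (intro antisym INF_greatest INF_lower2[of p]) auto
qed

text \<open>Moving the shift to the other side keeps the count in \<open>nat\<close>; for
  \<open>D a w = 0\<close> both sides count nothing, as no distance is negative.\<close>

lemma c_num_eq:
  assumes "a \<in> pverts G" "w \<in> pverts G"
  shows "c_num G a (D a w) w = card {u. (u, w) \<in> parcs G \<and> Suc (D a u) = D a w}"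
  unfolding c_num_def
  by (rule arg_cong[where f = card]) (use assms in_arcsD1 in \<open>auto simp: gdist_eq_D\<close>)

text \<open>By \<open>arc_D\<close> each neighbour of \<open>w\<close> is one step closer to
  \<open>a\<close> or one step farther away. The valency is that of \<open>w\<close>, hence the test
  \<open>w \<in> Y\<close>.\<close>

lemma b_num_eq:
  assumes "a \<in> pverts G" "w \<in> pverts G"
  shows "b_num G a (D a w) w = (if w \<in> Y then kY else kZ) - c_num G a (D a w) w"
proof -
  let ?N = "{u. (u, w) \<in> parcs G}" and ?C = "{u. (u, w) \<in> parcs G \<and> Suc (D a u) = D a w}"
  have fin: "finite ?N"
    using pair_finite_verts by (rule finite_subset[rotated]) (auto dest: in_arcsD1)
  have "{u. (u, w) \<in> parcs G \<and> gdist G a u = ereal (real (D a w) + 1)} = ?N - ?C"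
    (is "?B = _")
  proof (intro set_eqI)
    fix u
    show "u \<in> ?B \<longleftrightarrow> u \<in> ?N - ?C"
      using arc_D[OF assms(1), of u w] in_arcsD1[of u w] gdist_eq_D[OF assms(1), of u] by auto
  qed
  moreover have "card (?N - ?C) = card ?N - card ?C"
    by (rule card_Diff_subset) (auto intro: finite_subset[OF _ fin])
  ultimately show ?thesis
    using assms by (simp add: b_num_def c_num_eq card_nbhd)
qed

lemma c_num_eq_c:
  assumes "a \<in> pverts G" "w \<in> pverts G"
  shows "c_num G a (D a w) w = (if w = a then 0 else (if a \<in> Y then cY else cZ) (D a w))"
proof (cases "w = a")
  case True
  then have "D a w = 0" using assms D_eq_0_iff by simp
  then show ?thesis using True c_num_eq[OF assms] by simp
next
  case False
  then show ?thesis using c_num_eq[OF assms] card_pred[OF assms False] by simp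
qed

lemma verts_eq: "pverts G = Y \<union> Z" and parts_disjoint: "Y \<inter> Z = {}"
  using bip by (auto simp: bipartite_graph_def)

lemma distance_biregular: "distance_biregular G Y Z"
proof -
  have "\<exists>c b. \<forall>a \<in> P. \<forall>w \<in> pverts G.
      gdist G a w = ereal (real i) \<longrightarrow> c_num G a i w = c \<and> b_num G a i w = b"
    if "P \<in> {Y, Z}" for P i
  proof -
    \<comment> \<open>At \<open>i = 0\<close> the vertex \<open>w\<close> is \<open>a\<close>
      itself, and no neighbour is closer; the values \<open>cY 0\<close> and \<open>cZ 0\<close> are
      left free by the locale.\<close>
    define c where "c = (if i = 0 then 0 else (if P = Y then cY else cZ) i)"
    \<comment> \<open>The parity of \<open>i\<close> together with \<open>P\<close> tells which part
      contains \<open>w\<close>, and so which valency to take.\<close>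
    define b where "b = (if even i \<longleftrightarrow> P = Y then kY else kZ) - c"
    have "c_num G a i w = c \<and> b_num G a i w = b"
      if a: "a \<in> P" and w: "w \<in> pverts G" and dist: "gdist G a w = ereal (real i)" for a w
    proof -
      have aG: "a \<in> pverts G" using a \<open>P \<in> {Y, Z}\<close> verts_eq by auto
      have i: "i = D a w" using gdist_eq_D[OF aG w] dist by simp
      have P: "P = Y \<longleftrightarrow> a \<in> Y"
        using a \<open>P \<in> {Y, Z}\<close> parts_disjoint by auto
      have "c_num G a i w = c"
        using c_num_eq_c[OF aG w] D_eq_0_iff[OF aG w] by (simp add: c_def P i)
      then show ?thesis
        using b_num_eq[OF aG w] D_parity[OF aG w] by (auto simp: b_def P i)
    qed
    then show ?thesis by blast
  qed
  then show ?thesis using bip by (simp add: distance_biregular_def)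
qed

text \<open>\<open>bound\<close> and \<open>attained\<close> pin the eccentricity to
  \<open>length cs\<close>; list position \<open>i\<close> holds the number for distance
  \<open>Suc i\<close>.\<close>

lemma array_line:
  assumes "P \<in> {Y, Z}"
    and bound: "\<And>a w. \<lbrakk>a \<in> P; w \<in> pverts G\<rbrakk> \<Longrightarrow> D a w \<le> length cs"
    and attained: "\<And>a. a \<in> P \<Longrightarrow> \<exists>w \<in> pverts G. D a w = length cs"
    and entries: "\<And>i. i < length cs \<Longrightarrow> cs ! i = real ((if P = Y then cY else cZ) (Suc i))"
  shows "array_line G P (if P = Y then kY else kZ) cs"
  unfolding array_line_def
proof (intro ballI conjI impI)
  fix a assume a: "a \<in> P"
  have aG: "a \<in> pverts G" using a \<open>P \<in> {Y, Z}\<close> verts_eq by auto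
  have P: "P = Y \<longleftrightarrow> a \<in> Y"
    using a \<open>P \<in> {Y, Z}\<close> parts_disjoint by auto
  have "out_arcs (with_proj G) a = Pair a ` {u. (u, a) \<in> parcs G}"
    by (auto simp: out_arcs_def dest: arcs_symmetric)
  then have "out_degree (with_proj G) a = card {u. (u, a) \<in> parcs G}"
    by (simp add: out_degree_def card_image inj_on_def)
  then show "out_degree (with_proj G) a = (if P = Y then kY else kZ)"
    using card_nbhd[OF aG] P by simp
  obtain w where w: "w \<in> pverts G" "D a w = length cs"
    using attained[OF a] by blast
  show "eccentricity G a = ereal (real (length cs))"
    unfolding eccentricity_def
    using w bound[OF a] aG by (intro antisym SUP_least SUP_upper2[of w]) (auto simp: gdist_eq_D)
next
  fix a i w assume a: "a \<in> P" and i: "i \<in> {1..length cs}" and w: "w \<in> pverts G"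
    and dist: "gdist G a w = ereal (real i)"
  have aG: "a \<in> pverts G" using a \<open>P \<in> {Y, Z}\<close> verts_eq by auto
  have P: "P = Y \<longleftrightarrow> a \<in> Y"
    using a \<open>P \<in> {Y, Z}\<close> parts_disjoint by auto
  have "i = D a w" using gdist_eq_D[OF aG w] dist by simp
  then show "real (c_num G a i w) = cs ! (i - 1)"
    using c_num_eq_c[OF aG w] D_eq_0_iff[OF aG w] entries[of "i - 1"] i P by auto
qed

end

section \<open>Cosets of subgroups with pairwise full sum\<close>

abbreviation coset_lines :: "'v::ab_group_add set set \<Rightarrow> 'v set set" where
  "coset_lines S \<equiv> \<Union>M \<in> S. cosets M"

text \<open>The candidate to be certified by \<open>distance_profile\<close>. Lying in a common
  coset is expressed through \<open>v - x\<close>, the form in which the covering hypothesis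
  applies.\<close>

fun incidence_dist :: "'v::ab_group_add set set \<Rightarrow> 'v + 'v set \<Rightarrow> 'v + 'v set \<Rightarrow> nat" where
  "incidence_dist S (Inl x) (Inl v) = (if v = x then 0 else if \<exists>M \<in> S. v - x \<in> M then 2 else 4)"
| "incidence_dist S (Inl x) (Inr B) = (if x \<in> B then 1 else 3)"
| "incidence_dist S (Inr A) (Inl v) = (if v \<in> A then 1 else 3)"
| "incidence_dist S (Inr A) (Inr B) = (if B = A then 0 else if A \<inter> B \<noteq> {} then 2 else 4)"

lemma pverts_incidence_graph: "pverts (incidence_graph S) = point_verts \<union> coset_verts S"
  by (simp add: incidence_graph_def Let_def)

lemma parcs_incidence_graph:
  "(Inl v, Inr B) \<in> parcs (incidence_graph S) \<longleftrightarrow> B \<in> coset_lines S \<and> v \<in> B"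
  "(Inr B, Inl v) \<in> parcs (incidence_graph S) \<longleftrightarrow> B \<in> coset_lines S \<and> v \<in> B"
  "(Inl v, Inl x) \<notin> parcs (incidence_graph S)"
  "(Inr A, Inr B) \<notin> parcs (incidence_graph S)"
  by (auto simp: incidence_graph_def Let_def)

text \<open>The free predicate \<open>P\<close> serves both valencies, with \<open>P\<close> always
  true, and predecessor counts, with \<open>P\<close> a condition on the distance.\<close>

lemma incidence_graph_in_arcs_Inl:
  "{u. (u, Inl v) \<in> parcs (incidence_graph S) \<and> P u} = Inr ` {B \<in> coset_lines S. v \<in> B \<and> P (Inr B)}"
  (is "?L = ?R")
proof (rule set_eqI)
  fix u show "u \<in> ?L \<longleftrightarrow> u \<in> ?R"
    by (cases u) (auto simp: parcs_incidence_graph)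
qed

lemma incidence_graph_in_arcs_Inr:
  assumes "B \<in> coset_lines S"
  shows "{u. (u, Inr B) \<in> parcs (incidence_graph S) \<and> P u} = Inl ` {v \<in> B. P (Inl v)}"
  (is "?L = ?R")
proof (rule set_eqI)
  fix u show "u \<in> ?L \<longleftrightarrow> u \<in> ?R"
    using assms by (cases u) (auto simp: parcs_incidence_graph)
qed

lemma bipartite_incidence_graph:
  fixes S :: "'v::ab_group_add set set"
  assumes fin: "finite (UNIV :: 'v set)"
  shows "bipartite_graph (incidence_graph S) point_verts (coset_verts S)"
proof -
  let ?G = "incidence_graph S"
  have finV: "finite (UNIV :: ('v + 'v set) set)"
    unfolding finite_Plus_UNIV_iff Finite_Set.finite_set using fin by blast
  have finA: "finite (parcs ?G)"
    by (rule finite_subset[OF subset_UNIV]) (unfold finite_prod, use finV in blast)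
  have fin': "finite (pverts ?G)"
    using finV by (rule finite_subset[OF subset_UNIV])
  have sub: "parcs ?G \<subseteq> (point_verts \<times> coset_verts S) \<union> (coset_verts S \<times> point_verts)"
    by (auto simp: incidence_graph_def Let_def point_verts_def coset_verts_def)
  have disj: "point_verts \<inter> coset_verts S = {}"
    by (auto simp: point_verts_def coset_verts_def)
  have "pair_graph ?G"
  proof
    show "fst e \<in> pverts ?G" "snd e \<in> pverts ?G" "fst e \<noteq> snd e" if "e \<in> parcs ?G" for e
      using that sub disj by (cases e; auto simp: pverts_incidence_graph)+
    show "symmetric (with_proj ?G)"
      unfolding symmetric_def with_proj_simps incidence_graph_def Let_def pair_pre_digraph.simps
      by (rule sym_Un_converse)
  qed (fact fin' finA)+
  then show ?thesis
    using sub disj by (simp add: bipartite_graph_def pverts_incidence_graph)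
qed

text \<open>The group-theoretic content of the theorem, with \<open>l\<close> and \<open>m\<close>
  standing for \<open>q ^ (n - k)\<close> and \<open>q ^ (n - 2 * k)\<close>. The distance 4 is
  reached from points by \<open>uncovered\<close> and from cosets by \<open>proper\<close>.\<close>

locale coset_geometry =
  fixes S :: "'v::ab_group_add set set" and s l m d :: nat
  assumes finite_points: "finite (UNIV :: 'v set)"
    and card_S: "card S = s" and s_ge_2: "2 \<le> s"
    and zero_mem: "M \<in> S \<Longrightarrow> 0 \<in> M"
    and diff_mem: "\<lbrakk>M \<in> S; x \<in> M; y \<in> M\<rbrakk> \<Longrightarrow> x - y \<in> M"
    and card_mem: "M \<in> S \<Longrightarrow> card M = l"
    and proper: "M \<in> S \<Longrightarrow> M \<noteq> UNIV"
    and sum_UNIV: "\<lbrakk>M \<in> S; M' \<in> S; M \<noteq> M'\<rbrakk> \<Longrightarrow> \<exists>x \<in> M. \<exists>y \<in> M'. v = x + y"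
    and card_Int: "\<lbrakk>M \<in> S; M' \<in> S; M \<noteq> M'\<rbrakk> \<Longrightarrow> card (M \<inter> M') = m"
    and d_pos: "0 < d"
    and cover: "v \<noteq> 0 \<Longrightarrow> card {M \<in> S. v \<in> M} \<in> {0, d}"
    and uncovered: "\<exists>v. v \<noteq> 0 \<and> card {M \<in> S. v \<in> M} = 0"
begin

section \<open>Arithmetic of subgroups and their cosets\<close>

lemma finite_pts: "finite (A :: 'v set)"
  using finite_points by (rule finite_subset[OF subset_UNIV])

lemma finite_S: "finite S"
  by (rule card_ge_0_finite) (use card_S s_ge_2 in linarith)

lemma mem_translate: "v \<in> (+) b ` M \<longleftrightarrow> v - b \<in> (M :: 'v set)"
proof
  assume "v - b \<in> M"
  then have "b + (v - b) \<in> (+) b ` M" by (rule imageI)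
  then show "v \<in> (+) b ` M" by simp
qed auto

lemma uminus_mem:
  assumes "M \<in> S" "x \<in> M"
  shows "- x \<in> M"
  using diff_mem[OF assms(1) zero_mem[OF assms(1)] assms(2)] by simp

lemma add_mem:
  assumes "M \<in> S" "x \<in> M" "y \<in> M"
  shows "x + y \<in> M"
  using diff_mem[OF assms(1,2) uminus_mem[OF assms(1,3)]] by simp

lemma diff_commute_mem: "M \<in> S \<Longrightarrow> x - y \<in> M \<longleftrightarrow> y - x \<in> M"
  using uminus_mem[of M "x - y"] uminus_mem[of M "y - x"] by auto

lemma translate_eq:
  assumes "M \<in> S" "v - b \<in> M"
  shows "(+) b ` M = (+) v ` M"
proof (rule set_eqI)
  fix x
  have "x - b = (x - v) + (v - b)" "x - v = (x - b) - (v - b)" by simp_all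
  then show "x \<in> (+) b ` M \<longleftrightarrow> x \<in> (+) v ` M"
    unfolding mem_translate using assms add_mem diff_mem by metis
qed

text \<open>Any point of a coset can serve as its base point, so cosets sharing a point can be
  rebased there.\<close>

lemma lineE:
  assumes "B \<in> coset_lines S" "v \<in> B"
  obtains M where "M \<in> S" "B = (+) v ` M"
proof -
  obtain b M where M: "M \<in> S" "B = (+) b ` M"
    using assms(1) by (auto simp: cosets_def)
  then have "B = (+) v ` M"
    using assms(2) translate_eq[of M v b] by (simp add: mem_translate)
  then show ?thesis using that M(1) by blast
qed

lemma translate_line: "M \<in> S \<Longrightarrow> (+) v ` M \<in> coset_lines S"
  by (auto simp: cosets_def)

lemma mem_translate_self: "M \<in> S \<Longrightarrow> v \<in> (+) v ` M"
  by (simp add: mem_translate zero_mem)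

lemma parallel_disjoint:
  assumes M: "M \<in> S" and v: "v \<notin> (+) a ` M"
  shows "(+) a ` M \<inter> (+) v ` M = {}"
proof (rule ccontr)
  assume "(+) a ` M \<inter> (+) v ` M \<noteq> {}"
  then obtain z where "z \<in> (+) a ` M" "z \<in> (+) v ` M" by blast
  then have "(+) a ` M = (+) v ` M"
    using translate_eq[OF M, of z] by (simp add: mem_translate)
  then show False using v mem_translate_self[OF M] by blast
qed

lemma translate_inject: "(+) v ` M = (+) v ` M' \<longleftrightarrow> M = (M' :: 'v set)"
  by (simp add: inj_image_eq_iff)

lemma inj_on_translate: "inj_on (\<lambda>M. (+) v ` M) (A :: 'v set set)"
  by (simp add: inj_on_def translate_inject)

section \<open>Counting points and cosets\<close>

lemma card_line:
  assumes "B \<in> coset_lines S"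
  shows "card B = l"
  using assms card_mem by (auto simp: cosets_def card_image)

lemma other_exists:
  obtains M' where "M' \<in> S" "M' \<noteq> M"
proof -
  have "\<not> S \<subseteq> {M}"
    using card_mono[of "{M}" S] card_S s_ge_2 by auto
  then show ?thesis using that by blast
qed

lemma l_pos: "0 < l"
proof -
  obtain M where M: "M \<in> S"
    by (metis other_exists)
  then show ?thesis
    using zero_mem[OF M] card_mem[OF M] finite_pts[of M] by (auto simp: card_gt_0_iff)
qed

text \<open>Each member of \<open>S\<close> has exactly one coset through \<open>v\<close>; as
  translation by \<open>v\<close> is injective, the valency of a point is \<open>s\<close>.\<close>

lemma lines_through: "{B \<in> coset_lines S. v \<in> B} = (\<lambda>M. (+) v ` M) ` S"
proof
  show "{B \<in> coset_lines S. v \<in> B} \<subseteq> (\<lambda>M. (+) v ` M) ` S"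
    by (metis (no_types, lifting) imageI lineE mem_Collect_eq subsetI)
  show "(\<lambda>M. (+) v ` M) ` S \<subseteq> {B \<in> coset_lines S. v \<in> B}"
    using translate_line mem_translate_self by blast
qed

lemma card_lines_through: "card {B \<in> coset_lines S. v \<in> B} = s"
  by (simp only: lines_through card_image[OF inj_on_translate] card_S)

text \<open>The bijection sending \<open>M\<close> to its coset through \<open>v\<close> matches the
  cosets that also contain \<open>x\<close> with the members containing \<open>x - v\<close>,
  equivalently \<open>v - x\<close>.\<close>

lemma card_lines_through_two:
  "card {B \<in> coset_lines S. v \<in> B \<and> x \<in> B} = card {M \<in> S. v - x \<in> M}"
proof -
  have "{B \<in> coset_lines S. v \<in> B \<and> x \<in> B} = {B \<in> (\<lambda>M. (+) v ` M) ` S. x \<in> B}"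
    unfolding lines_through[symmetric] by blast
  also have "\<dots> = (\<lambda>M. (+) v ` M) ` {M \<in> S. v - x \<in> M}"
    unfolding Compr_image_eq mem_translate
    by (intro arg_cong[where f = "image _"] Collect_cong conj_cong refl diff_commute_mem)
  finally show ?thesis
    by (simp only: card_image[OF inj_on_translate])
qed

lemma covered_iff: "v \<noteq> 0 \<Longrightarrow> card {M \<in> S. v \<in> M} = (if \<exists>M \<in> S. v \<in> M then d else 0)"
  using cover[of v] finite_S d_pos by (auto simp: card_eq_0_iff)

text \<open>Writing \<open>b' - b = x + y\<close> with \<open>x \<in> M\<close> and
  \<open>y \<in> M'\<close> gives the common point \<open>b + x = b' - y\<close>.\<close>

lemma not_parallel_meet:
  assumes "M \<in> S" "M' \<in> S" "M \<noteq> M'"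
  obtains v where "v \<in> (+) b ` M" "v \<in> (+) b' ` M'"
proof -
  obtain x y where xy: "x \<in> M" "y \<in> M'" "b' - b = x + y"
    using sum_UNIV[OF assms, of "b' - b"] by blast
  have "b + x - b' = - y"
    using xy(3) by (simp add: algebra_simps)
  then have "b + x \<in> (+) b' ` M'"
    using uminus_mem[OF assms(2) xy(2)] by (simp add: mem_translate)
  then show ?thesis
    using that[of "b + x"] xy(1) by simp
qed

text \<open>Rebased at a common point, the intersection is a translate of
  \<open>M \<inter> M'\<close>.\<close>

lemma card_not_parallel_Int:
  assumes "M \<in> S" "M' \<in> S" "M \<noteq> M'"
  shows "card ((+) b ` M \<inter> (+) b' ` M') = m"
proof -
  obtain v where v: "v \<in> (+) b ` M" "v \<in> (+) b' ` M'"
    using not_parallel_meet[OF assms] .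
  then have "(+) b ` M \<inter> (+) b' ` M' = (+) v ` M \<inter> (+) v ` M'"
    using translate_eq assms by (simp add: mem_translate)
  also have "\<dots> = (+) v ` (M \<inter> M')"
    by (simp add: image_Int)
  finally show ?thesis
    by (simp add: card_image card_Int[OF assms])
qed

lemma m_pos: "0 < m"
proof -
  obtain M M' where M: "M \<in> S" "M' \<in> S" "M \<noteq> M'"
    by (metis other_exists)
  then have "0 \<in> M \<inter> M'" using zero_mem by simp
  then show ?thesis
    using card_Int[OF M] finite_pts[of "M \<inter> M'"] by (auto simp: card_gt_0_iff)
qed

text \<open>Double counting of the pairs \<open>(v, M')\<close> with \<open>v \<in> B\<close> and \<open>v - x \<in> M'\<close>: the direction of \<open>B\<close>
  contributes none, each other member of \<open>S\<close> contributes \<open>m\<close>.\<close>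

lemma card_covered_on_line:
  assumes B: "B \<in> coset_lines S" and x: "x \<notin> B"
  shows "d * card {v \<in> B. \<exists>M \<in> S. v - x \<in> M} = m * (s - 1)"
proof -
  obtain b M where M: "M \<in> S" "B = (+) b ` M"
    using B by (auto simp: cosets_def)
  have count: "card {v \<in> B. v - x \<in> M'} = (if M' = M then 0 else m)" if "M' \<in> S" for M'
  proof (cases "M' = M")
    case True
    have "v - x \<notin> M" if "v \<in> B" for v
      using parallel_disjoint[OF M(1), of x b] x that M(2) mem_translate[of v x M] by blast
    then have "{v \<in> B. v - x \<in> M'} = {}" using True by blast
    then show ?thesis using True by (simp only: card.empty if_True simp_thms)
  next
    case False
    have "{v \<in> B. v - x \<in> M'} = (+) b ` M \<inter> (+) x ` M'"
      by (simp add: set_eq_iff mem_translate M(2))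
    then show ?thesis
      using card_not_parallel_Int[OF M(1) that] False by simp
  qed
  have "(\<Sum>v \<in> B. card {M' \<in> S. v - x \<in> M'}) = (\<Sum>M' \<in> S. card {v \<in> B. v - x \<in> M'})"
    using sum.swap_restrict[OF finite_pts[of B] finite_S, of "\<lambda>_ _. 1 :: nat" "\<lambda>v M'. v - x \<in> M'"]
    by simp
  also have "\<dots> = (\<Sum>M' \<in> S. if M' = M then 0 else m)"
    by (intro sum.cong refl count)
  also have "\<dots> = (\<Sum>M' \<in> S - {M}. m)"
    by (rule sum.mono_neutral_cong_right) (use finite_S in auto)
  also have "\<dots> = m * (s - 1)"
    using M finite_S card_S by simp
  finally have "(\<Sum>v \<in> B. card {M' \<in> S. v - x \<in> M'}) = m * (s - 1)" .
  \<comment> \<open>The same sum taken point by point: a covered difference counts \<open>d\<close>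
    times, any other not at all. Since \<open>x \<notin> B\<close>, the differences are nonzero, as
    \<open>covered_iff\<close> demands.\<close>
  moreover have "(\<Sum>v \<in> B. card {M' \<in> S. v - x \<in> M'}) = (\<Sum>v \<in> {v \<in> B. \<exists>M \<in> S. v - x \<in> M}. d)"
  proof (rule sum.mono_neutral_cong_right)
    show "card {M' \<in> S. v - x \<in> M'} = d" if "v \<in> {v \<in> B. \<exists>M \<in> S. v - x \<in> M}" for v
      using that covered_iff[of "v - x"] x by auto
    show "\<forall>v \<in> B - {v \<in> B. \<exists>M \<in> S. v - x \<in> M}. card {M' \<in> S. v - x \<in> M'} = 0"
      by (auto simp: card_eq_0_iff)
  qed (use finite_pts in auto)
  ultimately show ?thesis by (simp add: mult.commute)
qed

lemma vert_cases:
  assumes "a \<in> pverts (incidence_graph S)"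
  obtains (point) x where "a = Inl x" | (line) A where "a = Inr A" "A \<in> coset_lines S"
  using assms by (auto simp: pverts_incidence_graph point_verts_def coset_verts_def)

lemma Inl_in_point_verts: "Inl x \<in> point_verts" and Inr_notin_point_verts: "Inr A \<notin> point_verts"
  by (auto simp: point_verts_def)

lemma Inl_in_verts: "Inl x \<in> pverts (incidence_graph S)"
  by (simp add: pverts_incidence_graph Inl_in_point_verts)

lemma Inr_in_verts: "A \<in> coset_lines S \<Longrightarrow> Inr A \<in> pverts (incidence_graph S)"
  by (simp add: pverts_incidence_graph coset_verts_def)

lemma exists_point_off_translate:
  assumes "M \<in> S"
  obtains x where "x \<notin> (+) b ` M"
proof -
  obtain y where "y \<notin> M" using proper[OF assms] by blast
  then have "b + y \<notin> (+) b ` M" by (simp add: mem_translate)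
  then show ?thesis using that by blast
qed

text \<open>The double count for one coset and one point off it exhibits \<open>m * (s - 1)\<close>
  as a multiple of \<open>d\<close>, so the integer quotient is exact.\<close>

lemma d_dvd: "d * (m * (s - 1) div d) = m * (s - 1)"
proof -
  obtain M where M: "M \<in> S" by (metis other_exists)
  obtain x where x: "x \<notin> (+) 0 ` M" using exists_point_off_translate[OF M] .
  have "d dvd m * (s - 1)"
    unfolding card_covered_on_line[OF translate_line[OF M] x, symmetric] by simp
  then show ?thesis by simp
qed

lemma card_covered_on_line_eq_div:
  assumes "B \<in> coset_lines S" "x \<notin> B"
  shows "card {v \<in> B. \<exists>M \<in> S. v - x \<in> M} = m * (s - 1) div d"
  unfolding card_covered_on_line[OF assms, symmetric] using d_pos by simp

lemma collinear_iff:
  "(\<exists>M \<in> S. v - x \<in> M) \<longleftrightarrow> (\<exists>B \<in> coset_lines S. v \<in> B \<and> x \<in> B)"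
proof
  assume "\<exists>M \<in> S. v - x \<in> M"
  then obtain M where M: "M \<in> S" "v - x \<in> M" by blast
  then show "\<exists>B \<in> coset_lines S. v \<in> B \<and> x \<in> B"
    using translate_line[OF M(1), of x] mem_translate_self[OF M(1), of x] mem_translate[of v x M]
    by blast
next
  assume "\<exists>B \<in> coset_lines S. v \<in> B \<and> x \<in> B"
  then show "\<exists>M \<in> S. v - x \<in> M"
    by (metis lineE mem_translate)
qed

text \<open>Of the \<open>s\<close> cosets through \<open>v\<close>, exactly the one parallel to
  \<open>A\<close> misses \<open>A\<close>. This yields the third number from a coset;
  \<open>B \<noteq> A\<close> matches the way \<open>incidence_dist\<close> unfolds.\<close>

lemma card_lines_meeting:
  assumes A: "A \<in> coset_lines S" and v: "v \<notin> A"
  shows "card {B \<in> coset_lines S. v \<in> B \<and> B \<noteq> A \<and> A \<inter> B \<noteq> {}} = s - 1"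
proof -
  obtain a M where M: "M \<in> S" "A = (+) a ` M"
    using A by (auto simp: cosets_def)
  have meet_iff: "(+) v ` M' \<noteq> A \<and> A \<inter> (+) v ` M' \<noteq> {} \<longleftrightarrow> M' \<noteq> M" if M': "M' \<in> S" for M'
  proof (cases "M' = M")
    case True
    have "A \<inter> (+) v ` M = {}"
      using parallel_disjoint[OF M(1)] v M(2) by blast
    then show ?thesis using True by blast
  next
    case False
    obtain z where "z \<in> A" "z \<in> (+) v ` M'"
      using not_parallel_meet[OF M(1) M', of a v] False M(2) by blast
    then show ?thesis
      using False v mem_translate_self[OF M'] by blast
  qed
  have "{B \<in> coset_lines S. v \<in> B \<and> B \<noteq> A \<and> A \<inter> B \<noteq> {}}
      = {B \<in> {B \<in> coset_lines S. v \<in> B}. B \<noteq> A \<and> A \<inter> B \<noteq> {}}"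
    by simp
  also have "\<dots> = (\<lambda>M'. (+) v ` M') ` {M' \<in> S. M' \<noteq> M}"
    unfolding lines_through Compr_image_eq
    by (intro arg_cong[where f = "image _"] Collect_cong conj_cong refl meet_iff)
  also have "{M' \<in> S. M' \<noteq> M} = S - {M}" by blast
  finally show ?thesis
    using M(1) card_S finite_S by (simp only: card_image[OF inj_on_translate] card_Diff_singleton)
qed

text \<open>Rebased at a common point, distinct cosets must come from distinct members of
  \<open>S\<close>.\<close>

lemma card_line_Int:
  assumes A: "A \<in> coset_lines S" and B: "B \<in> coset_lines S" and "B \<noteq> A" and meet: "A \<inter> B \<noteq> {}"
  shows "card (A \<inter> B) = m"
proof -
  obtain v where v: "v \<in> A" "v \<in> B" using meet by blast
  obtain M where M: "M \<in> S" "A = (+) v ` M" using lineE[OF A v(1)] .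
  obtain M' where M': "M' \<in> S" "B = (+) v ` M'" using lineE[OF B v(2)] .
  show ?thesis
    using card_not_parallel_Int[OF M(1) M'(1)] M M' \<open>B \<noteq> A\<close> by blast
qed

text \<open>The leading \<open>0\<close> is padding that makes the list index equal to the
  distance.\<close>

definition point_c :: "nat \<Rightarrow> nat" where
  "point_c i = [0, 1, d, m * (s - 1) div d, s] ! i"

definition line_c :: "nat \<Rightarrow> nat" where
  "line_c i = [0, 1, m, s - 1, l] ! i"

lemma c_simps:
  "point_c (Suc 0) = 1" "point_c 2 = d" "point_c 3 = m * (s - 1) div d" "point_c 4 = s"
  "line_c (Suc 0) = 1" "line_c 2 = m" "line_c 3 = s - 1" "line_c 4 = l"
  by (simp_all add: point_c_def line_c_def)

text \<open>Prepares \<open>c_pos\<close>: because the division is exact, a zero quotient would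
  force \<open>m * (s - 1)\<close> to vanish.\<close>

lemma c_nums_pos:
  "0 < m * (s - 1) div d" "0 < s" "0 < s - 1"
proof -
  have "0 < m * (s - 1)" using m_pos s_ge_2 by simp
  then have "d * (m * (s - 1) div d) \<noteq> 0" by (simp only: d_dvd)
  then show "0 < m * (s - 1) div d" by (metis gr0I mult_0_right)
qed (use s_ge_2 in simp_all)

text \<open>A case split on the kinds of \<open>a\<close> and \<open>w\<close> and on their
  distance; in each case the predecessors form a set \<open>E\<close> counted before or read off
  directly.\<close>

lemma card_pred_incidence:
  assumes "a \<in> pverts (incidence_graph S)" "w \<in> pverts (incidence_graph S)" "w \<noteq> a"
  shows "card {u. (u, w) \<in> parcs (incidence_graph S) \<and>
             Suc (incidence_dist S a u) = incidence_dist S a w} =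
         (if a \<in> point_verts then point_c else line_c) (incidence_dist S a w)"
  using assms(1)
proof (cases rule: vert_cases)
  case a: (point x)
  show ?thesis
    using assms(2)
  proof (cases rule: vert_cases)
    case w: (point v)
    then have "v \<noteq> x" using a assms(3) by simp
    show ?thesis
    proof (cases "\<exists>M \<in> S. v - x \<in> M")
      case True
      then have dist: "incidence_dist S a w = 2" using a w \<open>v \<noteq> x\<close> by simp
      have E: "{B \<in> coset_lines S. v \<in> B \<and> Suc (incidence_dist S a (Inr B)) = 2}
          = {B \<in> coset_lines S. v \<in> B \<and> x \<in> B}"
        using a by (intro Collect_cong conj_cong refl) simp
      show ?thesis
        unfolding dist
        unfolding w incidence_graph_in_arcs_Inl E card_image[OF inj_Inr]
          card_lines_through_two
        using covered_iff[of "v - x"] True \<open>v \<noteq> x\<close>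
        by (simp add: c_simps a Inl_in_point_verts)
    next
      case False
      then have dist: "incidence_dist S a w = 4" using a w \<open>v \<noteq> x\<close> by simp
      \<comment> \<open>No coset through \<open>v\<close> contains \<open>x\<close>, so all
        \<open>s\<close> of them are at distance 3 from \<open>x\<close>.\<close>
      have "x \<notin> B" if "B \<in> coset_lines S" "v \<in> B" for B
        using False that unfolding collinear_iff by blast
      then have E: "{B \<in> coset_lines S. v \<in> B \<and> Suc (incidence_dist S a (Inr B)) = 4}
          = {B \<in> coset_lines S. v \<in> B}"
        using a by (intro Collect_cong conj_cong refl) auto
      show ?thesis
        unfolding dist
        unfolding w incidence_graph_in_arcs_Inl E card_image[OF inj_Inr]
          card_lines_through
        by (simp add: c_simps a Inl_in_point_verts Inr_notin_point_verts)
    qed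
  next
    case w: (line B)
    show ?thesis
    proof (cases "x \<in> B")
      case True
      then have dist: "incidence_dist S a w = 1" using a w by simp
      have E: "{v \<in> B. Suc (incidence_dist S a (Inl v)) = 1} = {x}"
        using a True by auto
      show ?thesis
        unfolding dist
        unfolding w(1) incidence_graph_in_arcs_Inr[OF w(2)] E card_image[OF inj_Inl]
        by (simp add: c_simps a Inl_in_point_verts)
    next
      case False
      then have dist: "incidence_dist S a w = 3" using a w by simp
      \<comment> \<open>As \<open>x \<notin> B\<close>, no point of \<open>B\<close> equals
        \<open>x\<close>, so distance 2 just means a covered difference.\<close>
      have E: "{v \<in> B. Suc (incidence_dist S a (Inl v)) = 3} = {v \<in> B. \<exists>M \<in> S. v - x \<in> M}"
        using a False by (intro Collect_cong conj_cong refl) auto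
      show ?thesis
        unfolding dist
        unfolding w(1) incidence_graph_in_arcs_Inr[OF w(2)] E card_image[OF inj_Inl]
          card_covered_on_line_eq_div[OF w(2) False]
        by (simp add: c_simps a Inl_in_point_verts Inr_notin_point_verts)
    qed
  qed
next
  case a: (line A)
  show ?thesis
    using assms(2)
  proof (cases rule: vert_cases)
    case w: (point v)
    show ?thesis
    proof (cases "v \<in> A")
      case True
      then have dist: "incidence_dist S a w = 1" using a w by simp
      have E: "{B \<in> coset_lines S. v \<in> B \<and> Suc (incidence_dist S a (Inr B)) = 1} = {A}"
        using a True by (auto split: if_splits)
      show ?thesis
        unfolding dist
        unfolding w incidence_graph_in_arcs_Inl E card_image[OF inj_Inr]
        by (simp add: c_simps a Inr_notin_point_verts)
    next
      case False
      then have dist: "incidence_dist S a w = 3" using a w by simp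
      have E: "{B \<in> coset_lines S. v \<in> B \<and> Suc (incidence_dist S a (Inr B)) = 3}
          = {B \<in> coset_lines S. v \<in> B \<and> B \<noteq> A \<and> A \<inter> B \<noteq> {}}"
        using a by (intro Collect_cong conj_cong refl) simp
      show ?thesis
        unfolding dist
        unfolding w incidence_graph_in_arcs_Inl E card_image[OF inj_Inr]
          card_lines_meeting[OF a(2) False]
        by (simp add: c_simps a Inl_in_point_verts Inr_notin_point_verts)
    qed
  next
    case w: (line B)
    then have "B \<noteq> A" using a assms(3) by simp
    show ?thesis
    proof (cases "A \<inter> B = {}")
      case False
      then have dist: "incidence_dist S a w = 2" using a w \<open>B \<noteq> A\<close> by simp
      have E: "{v \<in> B. Suc (incidence_dist S a (Inl v)) = 2} = A \<inter> B"
        using a by auto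
      show ?thesis
        unfolding dist
        unfolding w(1) incidence_graph_in_arcs_Inr[OF w(2)] E card_image[OF inj_Inl]
          card_line_Int[OF a(2) w(2) \<open>B \<noteq> A\<close> False]
        by (simp add: c_simps a Inl_in_point_verts Inr_notin_point_verts)
    next
      case True
      then have dist: "incidence_dist S a w = 4" using a w \<open>B \<noteq> A\<close> by simp
      \<comment> \<open>Disjointness puts every point of \<open>B\<close> at distance 3 from
        \<open>A\<close>.\<close>
      have E: "{v \<in> B. Suc (incidence_dist S a (Inl v)) = 4} = B"
        using a True by auto
      show ?thesis
        unfolding dist
        unfolding w(1) incidence_graph_in_arcs_Inr[OF w(2)] E card_image[OF inj_Inl]
          card_line[OF w(2)]
        by (simp add: c_simps a Inl_in_point_verts Inr_notin_point_verts)
    qed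
  qed
qed

section \<open>Certifying the distance function\<close>

lemma incidence_dist_range:
  assumes "w \<noteq> a"
  shows "incidence_dist S a w \<in> {1, 2, 3, 4}"
  using assms by (cases a; cases w) auto

text \<open>The two values differ in parity, so a failure would jump from 0 to 3 or from 1 to 4.
  Incidence excludes the first; a shared coset or a shared point excludes the second.\<close>

lemma incidence_dist_adj:
  assumes "(u, w) \<in> parcs (incidence_graph S)"
  shows "incidence_dist S a w \<le> Suc (incidence_dist S a u)"
proof (cases u)
  case u: (Inl v)
  then obtain B where B: "w = Inr B" "v \<in> B"
    using assms by (cases w) (auto simp: parcs_incidence_graph)
  then show ?thesis
    using u by (cases a) auto
next
  case u: (Inr B)
  then obtain v where w: "w = Inl v" "B \<in> coset_lines S" "v \<in> B"
    using assms by (cases w) (auto simp: parcs_incidence_graph)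
  show ?thesis
  proof (cases a)
    case (Inl x)
    moreover have "\<exists>M \<in> S. v - x \<in> M" if "x \<in> B"
      using that w unfolding collinear_iff by blast
    ultimately show ?thesis using u w by auto
  next
    case (Inr A)
    then show ?thesis using u w by auto
  qed
qed

sublocale distance_profile "incidence_graph S" point_verts "coset_verts S" "incidence_dist S"
  point_c line_c s l
proof
  fix a w
  assume a: "a \<in> pverts (incidence_graph S)" and w: "w \<in> pverts (incidence_graph S)"
  show "incidence_dist S a w = 0 \<longleftrightarrow> w = a"
    by (cases a; cases w) auto
  show "even (incidence_dist S a w) \<longleftrightarrow> (a \<in> point_verts \<longleftrightarrow> w \<in> point_verts)"
    by (cases a; cases w) (auto simp: point_verts_def)
  assume "w \<noteq> a"
  then show "0 < (if a \<in> point_verts then point_c else line_c) (incidence_dist S a w)"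
    using incidence_dist_range[of w a] c_nums_pos d_pos m_pos l_pos
    by (auto simp: point_c_def line_c_def)
next
  fix a assume "a \<in> pverts (incidence_graph S)"
  then show "card {u. (u, a) \<in> parcs (incidence_graph S)} = (if a \<in> point_verts then s else l)"
  proof (cases rule: vert_cases)
    case (point x)
    then show ?thesis
      using incidence_graph_in_arcs_Inl[of x S "\<lambda>_. True"] card_lines_through[of x]
      by (simp add: card_image Inl_in_point_verts)
  next
    case (line A)
    then show ?thesis
      using incidence_graph_in_arcs_Inr[of A S "\<lambda>_. True"] card_line[of A]
      by (simp add: card_image Inr_notin_point_verts)
  qed
qed (use bipartite_incidence_graph[OF finite_points] incidence_dist_adj card_pred_incidence in auto)

text \<open>From a point, add an uncovered vector; from a coset, pass to a parallel coset through a
  point off it.\<close>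

lemma exists_dist_4:
  assumes "a \<in> pverts (incidence_graph S)"
  shows "\<exists>w \<in> pverts (incidence_graph S). incidence_dist S a w = 4"
  using assms
proof (cases rule: vert_cases)
  case (point x)
  obtain v where v: "v \<noteq> 0" "card {M \<in> S. v \<in> M} = 0" using uncovered by blast
  then have "\<forall>M \<in> S. v \<notin> M"
    using covered_iff[OF v(1)] d_pos by (metis less_irrefl)
  then have "incidence_dist S a (Inl (x + v)) = 4"
    using point v by simp
  then show ?thesis using Inl_in_verts by blast
next
  case (line A)
  then obtain b M where M: "M \<in> S" "A = (+) b ` M"
    by (auto simp: cosets_def)
  obtain x where x: "x \<notin> A" using exists_point_off_translate[OF M(1)] M(2) by blast
  let ?B = "(+) x ` M"
  have "A \<inter> ?B = {}"
    using parallel_disjoint[OF M(1)] x M(2) by blast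
  moreover have "?B \<noteq> A" using x mem_translate_self[OF M(1)] by blast
  ultimately have "incidence_dist S a (Inr ?B) = 4"
    using line by simp
  then show ?thesis using Inr_in_verts[OF translate_line[OF M(1)]] by blast
qed

lemma incidence_dist_le_4: "incidence_dist S a w \<le> 4"
  by (cases a; cases w) auto

lemma less_4_cases: "i < (4 :: nat) \<Longrightarrow> i = 0 \<or> i = 1 \<or> i = 2 \<or> i = 3"
  by linarith

lemma has_intersection_array:
  "has_intersection_array (incidence_graph S) point_verts (coset_verts S)
     (s, [1, real d, real m * (real s - 1) / real d, real s])
     (l, [1, real m, real s - 1, real l])"
proof -
  \<comment> \<open>Exactness of the division identifies the integer quotient in
    \<open>point_c\<close> with the real quotient of the array.\<close>
  have "real d * real (m * (s - 1) div d) = real m * (real s - 1)"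
    using arg_cong[OF d_dvd, of real] s_ge_2 by (simp add: of_nat_diff del: of_nat_div)
  then have quot: "real m * (real s - 1) / real d = real (m * (s - 1) div d)"
    using d_pos by (simp add: field_simps)
  have ne: "coset_verts S \<noteq> point_verts"
    by (auto simp: coset_verts_def point_verts_def)
  have len: "length [w, x, y, z] = 4" for w x y z :: real by simp
  have "array_line (incidence_graph S) point_verts
      (if point_verts = (point_verts :: ('v + 'v set) set) then s else l)
      [1, real d, real m * (real s - 1) / real d, real s]"
    unfolding quot
  proof (rule array_line, unfold len)
    show "[1, real d, real (m * (s - 1) div d), real s] ! i =
        real ((if point_verts = (point_verts :: ('v + 'v set) set) then point_c else line_c) (Suc i))"
      if "i < 4" for i
      using less_4_cases[OF that] by (auto simp: point_c_def)
  qed (use exists_dist_4 incidence_dist_le_4 pverts_incidence_graph[of S] in auto)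
  moreover have "array_line (incidence_graph S) (coset_verts S)
      (if coset_verts S = point_verts then s else l) [1, real m, real s - 1, real l]"
  proof (rule array_line, unfold len)
    show "[1, real m, real s - 1, real l] ! i =
        real ((if coset_verts S = point_verts then point_c else line_c) (Suc i))"
      if "i < 4" for i
      using less_4_cases[OF that] ne s_ge_2 by (auto simp: line_c_def of_nat_diff)
  qed (use exists_dist_4 incidence_dist_le_4 pverts_incidence_graph[of S] in auto)
  ultimately show ?thesis
    using ne by (simp add: has_intersection_array_def)
qed

end

section \<open>Subspaces over a finite field\<close>

text \<open>Coordinates biject onto the span: independence gives injectivity, and extensional
  functions leave no freedom outside \<open>B\<close>.\<close>

lemma (in vector_space) card_span_independent:
  fixes B :: "'b set"
  assumes "independent B" "finite B"
  shows "card (span B) = CARD('a) ^ card B"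
proof -
  let ?comb = "\<lambda>u. \<Sum>v \<in> B. scale (u v) v"
  have inj: "inj_on ?comb (B \<rightarrow>\<^sub>E UNIV)"
  proof (rule inj_onI)
    fix u u' assume u: "u \<in> B \<rightarrow>\<^sub>E UNIV" "u' \<in> B \<rightarrow>\<^sub>E UNIV" and eq: "?comb u = ?comb u'"
    have "(\<Sum>v \<in> B. scale (u v - u' v) v) = 0"
      using eq by (simp add: scale_left_diff_distrib sum_subtractf)
    then have "u v - u' v = 0" if "v \<in> B" for v
      using independentD[OF assms subset_refl, of "\<lambda>v. u v - u' v"] that by blast
    then show "u = u'"
      using u by (intro PiE_ext[OF u]) simp
  qed
  have image: "?comb ` (B \<rightarrow>\<^sub>E UNIV) = span B"
  proof -
    \<comment> \<open>Restricting the coefficients to \<open>B\<close> leaves the combination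
      unchanged.\<close>
    have "?comb u \<in> ?comb ` (B \<rightarrow>\<^sub>E UNIV)" for u
      by (rule image_eqI[of _ _ "restrict u B"]) (auto intro: sum.cong)
    then show ?thesis
      unfolding span_finite[OF assms(2)] by blast
  qed
  show ?thesis
    unfolding image[symmetric] card_image[OF inj] using assms(2) by (simp add: card_PiE)
qed

lemma (in finite_dimensional_vector_space) card_subspace:
  assumes "subspace M"
  shows "card M = CARD('a) ^ dim M"
proof -
  obtain B where B: "B \<subseteq> M" "independent B" "M \<subseteq> span B" "card B = dim M"
    using basis_exists by blast
  then have "span B = M"
    using assms span_minimal by blast
  then show ?thesis
    using card_span_independent[OF B(2) finiteI_independent[OF B(2)]] B(4) by simp
qed

theorem theorem5p2:
  fixes scale :: "'f::{field,finite} \<Rightarrow> 'v::ab_group_add \<Rightarrow> 'v"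
    and S :: "'v set set"
    and q n k s d :: nat
  assumes "vector_space scale"
    and "CARD('f) = q"
    and "vector_space.dim scale UNIV = n"
    and "0 < k" and "2 * k \<le> n"
    and "card S = s" and "2 \<le> s"
    and "\<And>M. M \<in> S \<Longrightarrow> module.subspace scale M"
    and "\<And>M. M \<in> S \<Longrightarrow> vector_space.dim scale M + k = n"
    and "2 \<le> d"
    and "\<And>v. v \<noteq> 0 \<Longrightarrow> card {M \<in> S. v \<in> M} \<in> {0, d}"
    and "\<exists>v. v \<noteq> 0 \<and> card {M \<in> S. v \<in> M} = 0"
    and "\<exists>v. v \<noteq> 0 \<and> card {M \<in> S. v \<in> M} = d"
    and "\<And>M M'. M \<in> S \<Longrightarrow> M' \<in> S \<Longrightarrow> M \<noteq> M' \<Longrightarrow> vector_space.dim scale (M \<inter> M') = n - 2 * k"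
  shows "distance_biregular (incidence_graph S) point_verts (coset_verts S) \<and>
         has_intersection_array (incidence_graph S) point_verts (coset_verts S)
           (s, [1, real d, real q ^ (n - 2 * k) * (real s - 1) / real d, real s])
           (q ^ (n - k), [1, real q ^ (n - 2 * k), real s - 1, real q ^ (n - k)])"
proof -
  interpret vector_space scale by fact
  obtain B where B: "independent B" "UNIV \<subseteq> span B" "card B = n"
    using basis_exists[of UNIV] assms(3) by auto
  \<comment> \<open>\<open>dim\<close> is 0 for infinite-dimensional spaces, so \<open>n > 0\<close> yields a finite basis.\<close>
  have "finite B"
    using B(3) assms(4,5) by (intro card_ge_0_finite) linarith
  then interpret finite_dimensional_vector_space scale B
    using B by unfold_locales auto
  have "CARD('v) = q ^ n"
    using card_subspace[OF subspace_UNIV] assms(2,3) by simp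
  \<comment> \<open>A positive \<open>card\<close> certifies finiteness, since infinite sets have
    \<open>card\<close> 0.\<close>
  moreover have "0 < q" using assms(2) by auto
  ultimately have finite_V: "finite (UNIV :: 'v set)"
    by (intro card_ge_0_finite) simp
  have dim_M: "dim M = n - k" if "M \<in> S" for M
    using assms(9)[OF that] by linarith
  have sum_UNIV: "{x + y |x y. x \<in> M \<and> y \<in> M'} = UNIV" if "M \<in> S" "M' \<in> S" "M \<noteq> M'" for M M'
  proof -
    let ?T = "{x + y |x y. x \<in> M \<and> y \<in> M'}"
    have "dim ?T + dim (M \<inter> M') = dim M + dim M'"
      using dim_sums_Int[OF assms(8)[OF that(1)] assms(8)[OF that(2)]] .
    \<comment> \<open>\<open>2 * (n - k) - (n - 2 * k) = n\<close>, where
      \<open>2 * k \<le> n\<close> keeps the subtractions exact.\<close>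
    then have "dim ?T = n"
      using dim_M that assms(5,14) by simp
    then have "span ?T = UNIV"
      using dim_eq_full[of ?T] assms(3) dim_UNIV by (simp add: dimension_def)
    moreover have "subspace ?T"
      using subspace_sums[OF assms(8)[OF that(1)] assms(8)[OF that(2)]] .
    ultimately show ?thesis
      using span_eq_iff[of ?T] by blast
  qed
  interpret coset_geometry S s "q ^ (n - k)" "q ^ (n - 2 * k)" d
  proof
    fix M assume M: "M \<in> S"
    show "0 \<in> M" using subspace_0 assms(8)[OF M] .
    show "x - y \<in> M" if "x \<in> M" "y \<in> M" for x y
      using subspace_diff[OF assms(8)[OF M] that] .
    show "card M = q ^ (n - k)"
      using card_subspace[OF assms(8)[OF M]] dim_M[OF M] assms(2) by simp
    \<comment> \<open>The whole space would have codimension 0, contradicting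
      \<open>0 < k\<close>.\<close>
    show "M \<noteq> UNIV"
      using assms(9)[OF M] assms(3,4) by auto
    fix M' assume M': "M' \<in> S" "M \<noteq> M'"
    show "\<exists>x \<in> M. \<exists>y \<in> M'. v = x + y" for v
      using sum_UNIV[OF M M'] by blast
    show "card (M \<inter> M') = q ^ (n - 2 * k)"
      using card_subspace[OF subspace_inter[OF assms(8)[OF M] assms(8)[OF M'(1)]]]
        assms(14)[OF M M'] assms(2) by simp
  qed (use finite_V assms(6,7,10,11,12) in auto)
  show ?thesis
    using distance_biregular has_intersection_array by simp
qed

end
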